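(* Let $n\ge1$ be a natural number and let $m\in\{1,\dots,n\}$. For any $p_n$ and $p_{n+1}$ in the interval $[0,1]$ such that $p_n>p_{n+1}$, the following statements hold: (i) If $(n+1)p_{n+1}\ge np_n$ and $m\ge 1+np_n$, then $\mathsf P(X_{n+1,p_{n+1}}\ge m)>\mathsf P(X_{n,p_n}\ge m)$. (ii) If $(n+1)p_{n+1}\le np_n$ and $m\le 1+np_{n+1}$, then $\mathsf P(X_{n+1,p_{n+1}}\ge m)<\mathsf P(X_{n,p_n}\ge m)$.
   Context: $X_{n,p}$ denotes a random variable having the binomial distribution with parameters $n$ and $p$, i.e. $\mathsf P(X_{n,p}=k)=\binom nk p^k(1-p)^{n-k}$ for $k=0,\dots,n$ (with $X_{n,0}=0$ and $X_{n,1}=n$ almost surely in the degenerate cases $p=0$, $p=1$). *)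

theory Defs
  imports "HOL-Probability.Probability"
begin

end

theory Submission
  imports Defs
begin

text \<open>
  Put \<open>m = j + 1\<close> and keep the sum \<open>x\<close> of the success probabilities fixed. Interpolate between
  \<open>n + 1\<close> trials of probability \<open>x / (n + 1)\<close> and \<open>n\<close> trials of probability \<open>x / n\<close> by taking \<open>n\<close>
  trials of probability \<open>a\<close> and one further trial of probability \<open>b = x - n * a\<close>. The probability of
  at least \<open>m\<close> successes has derivative \<open>Bernstein n j a * (a - b) * (n * a - j) / (a * (1 - a))\<close>
  in \<open>a\<close>, so on the range \<open>x / (n + 1) < a < x / n\<close>, where \<open>b < a\<close>, its sign is that of
  \<open>n * a - j\<close>. Each hypothesis on \<open>m\<close> fixes this sign. The remaining slack between
  \<open>n * p\<close> and \<open>(n + 1) * p'\<close> is absorbed by monotonicity of the tail in the probability.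
\<close>

definition binomial_tail :: "nat \<Rightarrow> nat \<Rightarrow> real \<Rightarrow> real" where
  "binomial_tail n m a = (\<Sum>k=m..n. Bernstein n k a)"

lemma prob_binomial_pmf_atLeast:
  assumes "0 \<le> p" "p \<le> 1"
  shows "measure_pmf.prob (binomial_pmf n p) {k. k \<ge> m} = binomial_tail n m p"
proof -
  have "measure_pmf.prob (binomial_pmf n p) {k. k \<ge> m} = measure_pmf.prob (binomial_pmf n p) {m..n}"
    by (rule measure_prob_cong_0) (use assms in \<open>auto simp: binomial_eq_0\<close>)
  then show ?thesis
    using assms by (simp add: measure_measure_pmf_finite binomial_tail_def Bernstein_def)
qed

lemma Bernstein_Suc_ratio:
  assumes "j < n"
  shows "(real n - real j) * a * Bernstein n j a = real (Suc j) * (1 - a) * Bernstein n (Suc j) a"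
proof -
  have "Suc j * (n choose Suc j) = (n - j) * (n choose j)"
    using binomial_absorb_comp[of n j] Suc_times_binomial_eq[of "n - 1" j] assms
    by (cases n) (auto simp: mult.commute)
  then have "real (Suc j) * real (n choose Suc j) = (real n - real j) * real (n choose j)"
    using assms by (metis less_imp_le of_nat_diff of_nat_mult)
  moreover have "(1 - a) ^ (n - j) = (1 - a) * (1 - a) ^ (n - Suc j)"
    using assms by (metis Suc_diff_Suc power_Suc)
  ultimately show ?thesis
    unfolding Bernstein_def by (simp add: mult_ac)
qed

text \<open>Pascal's rule, or conditioning on the last trial. For \<open>k \<ge> n\<close> the
  coefficient of \<open>Bernstein n (Suc k)\<close> vanishes, so no bound on \<open>k\<close> is
  assumed.\<close>

lemma Bernstein_Suc_Suc:
  "Bernstein (Suc n) (Suc k) a = a * Bernstein n k a + (1 - a) * Bernstein n (Suc k) a"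
proof (cases "k < n")
  case True
  then have "(1 - a) ^ (n - k) = (1 - a) * (1 - a) ^ (n - Suc k)"
    by (metis Suc_diff_Suc power_Suc)
  then show ?thesis
    by (simp only: Bernstein_def diff_Suc_Suc) (simp add: algebra_simps)
next
  case False
  then show ?thesis
    by (simp add: Bernstein_def binomial_eq_0)
qed

lemma DERIV_Bernstein:
  assumes "0 < a" "a < 1" "j \<le> n"
  shows "((\<lambda>a. Bernstein n j a) has_real_derivative
           Bernstein n j a * (real j - real n * a) / (a * (1 - a))) (at a)"
proof -
  \<comment> \<open>At \<open>i = 0\<close> the subtraction truncates, but the factor
    \<open>real i\<close> makes both sides zero.\<close>
  have powr: "real i * c ^ (i - Suc 0) = real i * c ^ i / c" if "c > 0" for i and c :: real
    using that by (cases i) auto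
  have "((\<lambda>a. Bernstein n j a) has_real_derivative
          real (n choose j) * ((real j * a ^ (j - Suc 0)) * (1 - a) ^ (n - j)
            - a ^ j * (real (n - j) * (1 - a) ^ (n - j - Suc 0)))) (at a)"
    unfolding Bernstein_def
    by (auto intro!: derivative_eq_intros simp: algebra_simps)
  also have "real (n choose j) * ((real j * a ^ (j - Suc 0)) * (1 - a) ^ (n - j)
            - a ^ j * (real (n - j) * (1 - a) ^ (n - j - Suc 0)))
      = Bernstein n j a * (real j / a - (real n - real j) / (1 - a))"
    using assms powr[of a j] powr[of "1 - a" "n - j"]
    by (simp add: Bernstein_def algebra_simps of_nat_diff)
  also have "real j / a - (real n - real j) / (1 - a) = (real j - real n * a) / (a * (1 - a))"
    using assms by (simp add: divide_simps) (simp add: algebra_simps)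
  finally show ?thesis by simp
qed

text \<open>Either the first \<open>n\<close> trials already contain \<open>j + 1\<close> successes,
  or they contain exactly \<open>j\<close> and the extra trial succeeds.\<close>

lemma binomial_tail_Suc:
  "binomial_tail (Suc n) (Suc j) a = binomial_tail n (Suc j) a + a * Bernstein n j a" if "j \<le> n"
proof -
  have "binomial_tail (Suc n) (Suc j) a = (\<Sum>k=j..n. Bernstein (Suc n) (Suc k) a)"
    by (simp only: binomial_tail_def sum.shift_bounds_cl_Suc_ivl)
  also have "\<dots> = a * (\<Sum>k=j..n. Bernstein n k a) + (1 - a) * (\<Sum>k=Suc j..Suc n. Bernstein n k a)"
    unfolding sum.shift_bounds_cl_Suc_ivl Bernstein_Suc_Suc
    by (simp add: sum.distrib sum_distrib_left)
  also have "(\<Sum>k=Suc j..Suc n. Bernstein n k a) = binomial_tail n (Suc j) a"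
    using that by (simp add: binomial_tail_def Bernstein_def binomial_eq_0)
  also have "(\<Sum>k=j..n. Bernstein n k a) = Bernstein n j a + binomial_tail n (Suc j) a"
    using that by (simp add: binomial_tail_def sum.atLeast_Suc_atMost)
  finally show ?thesis by (simp add: algebra_simps)
qed

text \<open>The derivatives of the summands telescope. The induction runs down from
  \<open>j = n\<close>, where the tail is empty, adding the lowest summand each time.\<close>

lemma DERIV_binomial_tail:
  assumes "0 < a" "a < 1" "j \<le> n"
  shows "((\<lambda>a. binomial_tail n (Suc j) a) has_real_derivative
           (real n - real j) * Bernstein n j a / (1 - a)) (at a)"
  using \<open>j \<le> n\<close>
proof (induction j rule: inc_induct)
  case base
  then show ?case by (simp add: binomial_tail_def)
next
  case (step j)
  have tail: "binomial_tail n (Suc j) = (\<lambda>a. Bernstein n (Suc j) a + binomial_tail n (Suc (Suc j)) a)"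
    using step by (auto simp: binomial_tail_def sum.atLeast_Suc_atMost)
  have "((\<lambda>a. binomial_tail n (Suc j) a) has_real_derivative
          Bernstein n (Suc j) a * (real (Suc j) - real n * a) / (a * (1 - a))
          + (real n - real (Suc j)) * Bernstein n (Suc j) a / (1 - a)) (at a)"
    unfolding tail using assms step by (intro DERIV_add DERIV_Bernstein step.IH) auto
  \<comment> \<open>Over the common denominator the factors add up to
    \<open>(j + 1 - n * a) + (n - j - 1) * a = (j + 1) * (1 - a)\<close>, which the ratio of
    consecutive weights turns into a multiple of \<open>Bernstein n j a\<close>.\<close>
  also have "Bernstein n (Suc j) a * (real (Suc j) - real n * a) / (a * (1 - a))
          + (real n - real (Suc j)) * Bernstein n (Suc j) a / (1 - a)
      = (real (Suc j) * (1 - a) * Bernstein n (Suc j) a) / (a * (1 - a))"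
    using assms by (simp add: divide_simps) (simp add: algebra_simps)
  also have "\<dots> = (real n - real j) * Bernstein n j a / (1 - a)"
    unfolding Bernstein_Suc_ratio[OF step(2), symmetric] using assms by simp
  finally show ?case .
qed

lemma continuous_on_Bernstein: "continuous_on S (Bernstein n k)"
  unfolding Bernstein_def by (intro continuous_intros)

lemma continuous_on_binomial_tail: "continuous_on S (binomial_tail n m)"
  unfolding binomial_tail_def by (intro continuous_intros continuous_on_Bernstein)

lemma binomial_tail_strict_mono:
  assumes "j < n" "0 \<le> a" "a < b" "b \<le> 1"
  shows "binomial_tail n (Suc j) a < binomial_tail n (Suc j) b"
proof (rule DERIV_pos_imp_increasing_open[OF \<open>a < b\<close>])
  fix x assume "a < x" "x < b"
  with assms have x: "0 < x" "x < 1" by auto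
  then have "(real n - real j) * Bernstein n j x / (1 - x) > 0"
    using assms by (simp add: Bernstein_def)
  then show "\<exists>y. (binomial_tail n (Suc j) has_real_derivative y) (at x) \<and> 0 < y"
    using DERIV_binomial_tail[OF x, of j n] assms by auto
qed (rule continuous_on_binomial_tail)

lemma binomial_tail_mono:
  assumes "j < n" "0 \<le> a" "a \<le> b" "b \<le> 1"
  shows "binomial_tail n (Suc j) a \<le> binomial_tail n (Suc j) b"
  using binomial_tail_strict_mono[of j n a b] assms by (cases "a = b") auto

text \<open>
  The probability of at least \<open>j + 1\<close> successes in \<open>n\<close> trials of probability \<open>a\<close> and one of
  probability \<open>x - n * a\<close>.
\<close>
definition mixed_tail :: "nat \<Rightarrow> nat \<Rightarrow> real \<Rightarrow> real \<Rightarrow> real" where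
  "mixed_tail n j x a = binomial_tail n (Suc j) a + (x - real n * a) * Bernstein n j a"

lemma mixed_tail_left:
  assumes "j \<le> n"
  shows "mixed_tail n j (real (n + 1) * a) a = binomial_tail (n + 1) (Suc j) a"
  using binomial_tail_Suc[OF assms, of a] by (simp add: mixed_tail_def algebra_simps)

lemma mixed_tail_right: "mixed_tail n j (real n * a) a = binomial_tail n (Suc j) a"
  by (simp add: mixed_tail_def)

lemma continuous_on_mixed_tail: "continuous_on S (mixed_tail n j x)"
  unfolding mixed_tail_def
  by (intro continuous_intros continuous_on_binomial_tail continuous_on_Bernstein)

text \<open>Over \<open>a * (1 - a)\<close> the outer terms give \<open>a * (n * a - j)\<close> and
  the middle one \<open>(x - n * a) * (j - n * a)\<close>; the common factor
  \<open>n * a - j\<close> splits off.\<close>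

lemma DERIV_mixed_tail:
  assumes "0 < a" "a < 1" "j \<le> n"
  shows "(mixed_tail n j x has_real_derivative
           Bernstein n j a / (a * (1 - a)) * ((real (n + 1) * a - x) * (real n * a - real j))) (at a)"
proof -
  let ?B = "Bernstein n j a"
  have "(mixed_tail n j x has_real_derivative
          (real n - real j) * ?B / (1 - a)
          + ((x - real n * a) * (?B * (real j - real n * a) / (a * (1 - a))) - real n * ?B)) (at a)"
    unfolding mixed_tail_def
    by (auto intro!: derivative_eq_intros DERIV_binomial_tail DERIV_Bernstein assms)
  also have "(real n - real j) * ?B / (1 - a)
          + ((x - real n * a) * (?B * (real j - real n * a) / (a * (1 - a))) - real n * ?B)
      = ?B / (a * (1 - a)) * ((real (n + 1) * a - x) * (real n * a - real j))"
    using assms by (simp add: divide_simps) (simp add: algebra_simps)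
  finally show ?thesis .
qed

lemma binomial_tail_less_fixed_mean:
  fixes p p' :: real
  assumes "j < n" "0 < p" "p \<le> 1" and mean: "real (n + 1) * p' = real n * p"
  shows "real n * p \<le> real j \<Longrightarrow> binomial_tail n (Suc j) p < binomial_tail (n + 1) (Suc j) p'"
    and "real j \<le> real n * p' \<Longrightarrow> binomial_tail (n + 1) (Suc j) p' < binomial_tail n (Suc j) p"
proof -
  let ?f = "mixed_tail n j (real n * p)"
  have n: "real n > 0" using \<open>j < n\<close> by simp
  have p': "0 < p'" using mean n \<open>0 < p\<close> by (metis mult_pos_pos of_nat_0_less_iff zero_less_mult_pos add_gr_0 zero_less_one)
  have "real n * p' < real n * p" using mean p' by (simp add: algebra_simps)
  then have less: "p' < p" using n by simp
  \<comment> \<open>The extra trial has probability \<open>0\<close> at \<open>a = p\<close>, and by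
    \<open>mean\<close> probability \<open>p'\<close> at \<open>a = p'\<close>.\<close>
  have ends: "?f p = binomial_tail n (Suc j) p" "?f p' = binomial_tail (n + 1) (Suc j) p'"
    using mixed_tail_right mixed_tail_left[of j n p'] \<open>j < n\<close> mean by auto
  have B: "Bernstein n j a / (a * (1 - a)) > 0" and b: "real (n + 1) * a - real n * p > 0"
    and d: "(?f has_real_derivative
      Bernstein n j a / (a * (1 - a)) * ((real (n + 1) * a - real n * p) * (real n * a - real j))) (at a)"
    if a: "p' < a" "a < p" for a
  proof -
    have a01: "0 < a" "a < 1" using a p' assms by auto
    then show "Bernstein n j a / (a * (1 - a)) > 0"
      using \<open>j < n\<close> by (simp add: Bernstein_def)
    have "real (n + 1) * p' < real (n + 1) * a" using a by (intro mult_strict_left_mono) auto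
    then show "real (n + 1) * a - real n * p > 0" by (simp only: mean diff_gt_0_iff_gt)
    show "(?f has_real_derivative
      Bernstein n j a / (a * (1 - a)) * ((real (n + 1) * a - real n * p) * (real n * a - real j))) (at a)"
      using DERIV_mixed_tail a01 \<open>j < n\<close> by simp
  qed
  show "binomial_tail n (Suc j) p < binomial_tail (n + 1) (Suc j) p'" if "real n * p \<le> real j"
    unfolding ends[symmetric]
  \<comment> \<open>The derivative formula divides by \<open>1 - a\<close> and \<open>p\<close> may
    be \<open>1\<close>, so only continuity is used at the ends.\<close>
  proof (rule DERIV_neg_imp_decreasing_open[OF less])
    fix a assume a: "p' < a" "a < p"
    have "real n * a < real n * p" using a n by simp
    with that have "real n * a - real j < 0" by simp
    with B[OF a] b[OF a] d[OF a] show "\<exists>y. (?f has_real_derivative y) (at a) \<and> y < 0"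
      by (meson mult_pos_neg)
  qed (rule continuous_on_mixed_tail)
  show "binomial_tail (n + 1) (Suc j) p' < binomial_tail n (Suc j) p" if "real j \<le> real n * p'"
    unfolding ends[symmetric]
  proof (rule DERIV_pos_imp_increasing_open[OF less])
    fix a assume a: "p' < a" "a < p"
    have "real n * p' < real n * a" using a n by simp
    with that have "real n * a - real j > 0" by simp
    with B[OF a] b[OF a] d[OF a] show "\<exists>y. (?f has_real_derivative y) (at a) \<and> 0 < y"
      by (meson mult_pos_pos)
  qed (rule continuous_on_mixed_tail)
qed

theorem theorem3:
  fixes n m :: nat and p p' :: real
  assumes "n \<ge> 1" and "m \<in> {1..n}"
    and "p \<in> {0..1}" and "p' \<in> {0..1}" and "p > p'"
  shows "(real (n + 1) * p' \<ge> real n * p \<and> real m \<ge> 1 + real n * p \<longrightarrow>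
            measure_pmf.prob (binomial_pmf (n + 1) p') {k. k \<ge> m}
              > measure_pmf.prob (binomial_pmf n p) {k. k \<ge> m}) \<and>
         (real (n + 1) * p' \<le> real n * p \<and> real m \<le> 1 + real n * p' \<longrightarrow>
            measure_pmf.prob (binomial_pmf (n + 1) p') {k. k \<ge> m}
              < measure_pmf.prob (binomial_pmf n p) {k. k \<ge> m})"
proof -
  obtain j where m: "m = Suc j" using assms(2) by (cases m) auto
  have j: "j < n" and n: "real n > 0" using assms(1,2) m by auto
  have p: "0 < p" "p \<le> 1" and p': "0 \<le> p'" "p' \<le> 1" using assms by auto
  have "binomial_tail n m p < binomial_tail (n + 1) m p'"
    if le: "real (n + 1) * p' \<ge> real n * p" and jn: "real m \<ge> 1 + real n * p"
  proof -
    \<comment> \<open>The bound on \<open>m\<close> involves \<open>p\<close>, so \<open>p\<close>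
      is kept and \<open>q\<close> gives \<open>n + 1\<close> trials the same mean.\<close>
    define q where "q = real n * p / real (n + 1)"
    have q: "real (n + 1) * q = real n * p" by (simp add: q_def)
    have "0 \<le> q" using p by (simp add: q_def)
    have "q \<le> p'" using le by (simp add: q_def divide_simps mult.commute)
    have "binomial_tail n (Suc j) p < binomial_tail (n + 1) (Suc j) q"
      using binomial_tail_less_fixed_mean(1)[OF j p q] jn m by simp
    also have "\<dots> \<le> binomial_tail (n + 1) (Suc j) p'"
      using j p' \<open>0 \<le> q\<close> \<open>q \<le> p'\<close> by (intro binomial_tail_mono) auto
    finally show ?thesis by (simp add: m)
  qed
  moreover have "binomial_tail (n + 1) m p' < binomial_tail n m p"
    if le: "real (n + 1) * p' \<le> real n * p" and jn: "real m \<le> 1 + real n * p'"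
  \<comment> \<open>The comparison at equal means needs a positive mean; for \<open>p' = 0\<close>
    the bound forces \<open>m = 1\<close>.\<close>
  proof (cases "p' = 0")
    case True
    then have "j = 0" using jn m by simp
    have "binomial_tail (n + 1) 1 0 = binomial_tail n 1 0"
      using binomial_tail_Suc[of 0 n 0] by simp
    also have "\<dots> < binomial_tail n 1 p"
      using binomial_tail_strict_mono[of 0 n 0 p] j p by simp
    finally show ?thesis using True m \<open>j = 0\<close> by simp
  next
    case False
    \<comment> \<open>Here the bound on \<open>m\<close> involves \<open>p'\<close>, so
      \<open>p'\<close> is kept and \<open>q\<close> matches its mean with \<open>n\<close>
      trials.\<close>
    define q where "q = real (n + 1) * p' / real n"
    have q: "real (n + 1) * p' = real n * q" using n by (simp add: q_def)
    have "0 < q" using False p' n by (simp add: q_def)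
    have "q \<le> p" using le n by (simp add: q_def divide_simps mult.commute)
    have "binomial_tail (n + 1) (Suc j) p' < binomial_tail n (Suc j) q"
      using binomial_tail_less_fixed_mean(2)[OF j \<open>0 < q\<close> _ q] \<open>q \<le> p\<close> p jn m by simp
    also have "\<dots> \<le> binomial_tail n (Suc j) p"
      using j p \<open>0 < q\<close> \<open>q \<le> p\<close> by (intro binomial_tail_mono) auto
    finally show ?thesis by (simp add: m)
  qed
  ultimately show ?thesis
    using p p' by (simp add: prob_binomial_pmf_atLeast del: of_nat_add)
qed

end
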